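(* For $a,b,c\in\mathbb Z_{\ge2}$, \begin{align*} &(1+(-1)^a)\zeta_3(a,b,c)+(1+(-1)^b)\{\zeta_3(b,a,c)+\zeta_3(b,c,a)\}+(-1)^b(1+(-1)^c)\zeta_3(c,b,a)\\ &=2\bigg\{\sum_{\xi=0}^{[a/2]}\zeta(2\xi)\sum_{\omega=0}^{a-2\xi}\binom{\omega+b-1}{\omega}\binom{a+c-2\xi-\omega-1}{c-1}\zeta_2(b+\omega,a+c-2\xi-\omega)\\ &\quad+\sum_{\xi=0}^{[b/2]}\zeta(2\xi)\sum_{\omega=0}^{a-1}\binom{\omega+b-2\xi}{\omega}\binom{a+c-\omega-2}{c-1}\zeta_2(b-2\xi+\omega+1,a+c-1-\omega)\\ &\quad+(-1)^b\sum_{\xi=0}^{[c/2]}\zeta(2\xi)\sum_{\omega=0}^{c-2\xi}\binom{\omega+b-1}{\omega}\binom{a+c-2\xi-\omega-1}{a-1}\zeta_2(b+\omega,a+c-2\xi-\omega)\\ &\quad+(-1)^b\sum_{\xi=0}^{[b/2]}\zeta(2\xi)\sum_{\omega=0}^{c-1}\binom{\omega+b-2\xi}{\omega}\binom{a+c-\omega-2}{a-1}\zeta_2(b-2\xi+\omega+1,a+c-1-\omega)\bigg\}\\ &\quad-\zeta_2(a+b,c)-(1+(-1)^b)\zeta_2(b,a+c)-(-1)^b\zeta_2(b+c,a). \end{align*}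
   Context: $\zeta_r(s_1,\ldots,s_r)=\sum_{0<n_1<\cdots<n_r}n_1^{-s_1}\cdots n_r^{-s_r}$ is the Euler–Zagier multiple zeta value (here $r=2,3$), $\zeta$ is the Riemann zeta-function (so $\zeta(0)=-1/2$), and $[x]$ denotes the integer part of $x$. *)

theory Defs
  imports "HOL-Analysis.Analysis"
begin

text \<open>Riemann zeta at nonnegative integers, as used in the paper: zeta 0 = -1/2,
  and for n \<ge> 2 the convergent series. (Only even arguments 2 xi are used; the
  value at n = 1 is never needed.)\<close>
definition rzeta :: "nat \<Rightarrow> real" where
  "rzeta n = (if n = 0 then - 1 / 2 else (\<Sum>k. 1 / (real (Suc k)) ^ n))"

definition mzv2 :: "nat \<Rightarrow> nat \<Rightarrow> real" where
  "mzv2 s1 s2 = infsum (\<lambda>(n1, n2). 1 / (real n1 ^ s1 * real n2 ^ s2))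
      {(n1, n2). 0 < n1 \<and> n1 < n2}"

definition mzv3 :: "nat \<Rightarrow> nat \<Rightarrow> nat \<Rightarrow> real" where
  "mzv3 s1 s2 s3 = infsum (\<lambda>(n1, n2, n3). 1 / (real n1 ^ s1 * real n2 ^ s2 * real n3 ^ s3))
      {(n1, n2, n3). 0 < n1 \<and> n1 < n2 \<and> n2 < n3}"

end

theory Submission
  imports Defs "HOL-Real_Asymp.Real_Asymp"
begin

text \<open>
  Sum \<open>1 / (x\<^sup>c y\<^sup>b z\<^sup>a)\<close> over all integer triples \<open>x < y < z\<close> with nonzero entries. Classifying the
  triples by the signs of their entries gives triple zeta values together with the products
  \<open>\<zeta>(c) \<zeta>\<^sub>2(b, a)\<close> and \<open>\<zeta>(a) \<zeta>\<^sub>2(b, c)\<close>, which the stuffle relation expands; up to the sign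
  \<open>(-1)\<close> to the power \<open>b + c\<close>, this is the left-hand side plus the three subtracted double zeta values.
  Alternatively fix the gaps \<open>m = z - y\<close> and \<open>n = y - x\<close> and sum over \<open>y\<close> first: this sums a rational
  function with poles \<open>-m\<close>, \<open>0\<close>, \<open>n\<close> over the integers, and its value is read off from the Laurent
  coefficients at the poles. Summing over \<open>m\<close> and \<open>n\<close>, the poles \<open>-m\<close> and \<open>n\<close> give
  double zeta values directly, while the pole \<open>0\<close> contributes terms \<open>1 / (m\<^sup>i n\<^sup>j)\<close> that are first
  converted by partial fractions with respect to \<open>m + n\<close>.
\<close>

subsection \<open>Sums of rational functions over the integers\<close>

text \<open>For \<open>u = p - q\<close> this is the Taylor series of \<open>1 / (x - q)\<close> at
  \<open>p\<close> in the local parameter \<open>t = x - p\<close>.\<close>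

definition fps_inv_lin :: "'a::field \<Rightarrow> 'a fps" where
  "fps_inv_lin u = inverse (fps_X + fps_const u)"

lemma fps_inv_lin_mult:
  assumes "u \<noteq> 0"
  shows "(fps_X + fps_const u) * fps_inv_lin u = 1"
  unfolding fps_inv_lin_def using assms by (intro inverse_mult_eq_1') simp

lemma fps_inv_lin_power_Suc:
  assumes "u \<noteq> 0"
  shows "(fps_X + fps_const u) * fps_inv_lin u ^ Suc k = fps_inv_lin u ^ k"
  by (simp only: power_Suc mult.assoc [symmetric] fps_inv_lin_mult [OF assms] mult_1)

text \<open>Multiplication by \<open>fps_X + fps_const u\<close> lowers \<open>b\<close> by one,
  which gives a recurrence in \<open>k\<close> solved by Pascal's rule. For \<open>b = 0\<close>
  truncated subtraction makes the binomial coefficient 1 at \<open>k = 0\<close> and 0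
  afterwards.\<close>

lemma fps_nth_inv_lin_power:
  assumes "u \<noteq> 0"
  shows "fps_nth (fps_inv_lin u ^ b) k
         = (-1) ^ k * of_nat ((b + k - 1) choose k) / (u :: 'a :: field) ^ (b + k)"
proof (induction b arbitrary: k)
  case 0
  show ?case by (cases k) (auto simp: binomial_eq_0)
next
  case (Suc b)
  note outer = Suc.IH
  define e where "e = fps_inv_lin u ^ Suc b"
  have "fps_X * e + fps_const u * e = fps_inv_lin u ^ b"
    using fps_inv_lin_power_Suc [OF assms, of b] by (simp add: e_def algebra_simps)
  hence rec: "fps_nth (fps_X * e) j + u * fps_nth e j = fps_nth (fps_inv_lin u ^ b) j" for j
    by (metis fps_add_nth fps_mult_left_const_nth)
  show ?case unfolding e_def [symmetric]
  proof (induction k)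
    case 0
    show ?case using rec [of 0] assms outer [of 0] by (simp add: field_simps)
  next
    case (Suc k)
    have "u * fps_nth e (Suc k) = fps_nth (fps_inv_lin u ^ b) (Suc k) - fps_nth e k"
      using rec [of "Suc k"] by (simp add: algebra_simps)
    also have "\<dots> = (-1) ^ Suc k * of_nat ((b + k) choose Suc k) / u ^ (b + Suc k)
        - (-1) ^ k * of_nat ((b + k) choose k) / u ^ (Suc b + k)"
      using Suc.IH outer [of "Suc k"] by simp
    also have "\<dots> = (-1) ^ Suc k * of_nat ((Suc b + k) choose Suc k) / u ^ (Suc b + k)"
      using assms by (simp add: field_simps)
    finally show ?case using assms by (simp add: field_simps)
  qed
qed

text \<open>The Taylor series of \<open>- pi t cot (pi t)\<close>. The coefficient of index
  \<open>a\<close> in its product with a Taylor series \<open>G(t)\<close> is thus the residue at 0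
  of \<open>- pi cot (pi t) G(t) / t^a\<close>.\<close>

definition zeta_even_fps :: "real fps" where
  "zeta_even_fps = Abs_fps (\<lambda>n. if even n then 2 * rzeta n else 0)"

lemma sum_even_atMost:
  fixes n :: nat
  shows "(\<Sum>i=0..n. if even i then f i else 0) = (\<Sum>\<xi>=0..n div 2. f (2 * \<xi>) :: 'a :: comm_monoid_add)"
proof -
  have "(\<Sum>i=0..n. if even i then f i else 0) = (\<Sum>i\<in>{i\<in>{0..n}. even i}. f i)"
    by (intro sum.inter_filter [symmetric]) auto
  also have "\<dots> = (\<Sum>\<xi>=0..n div 2. f (2 * \<xi>))"
    by (intro sum.reindex_bij_witness [of _ "\<lambda>\<xi>. 2 * \<xi>" "\<lambda>i. i div 2"]) auto
  finally show ?thesis .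
qed

lemma fps_nth_zeta_even_mult:
  "fps_nth (zeta_even_fps * G) n = 2 * (\<Sum>\<xi>=0..n div 2. rzeta (2 * \<xi>) * fps_nth G (n - 2 * \<xi>))"
proof -
  have "fps_nth (zeta_even_fps * G) n
      = (\<Sum>i=0..n. if even i then 2 * rzeta i * fps_nth G (n - i) else 0)"
    unfolding fps_mult_nth zeta_even_fps_def by (intro sum.cong) auto
  also have "\<dots> = (\<Sum>\<xi>=0..n div 2. 2 * rzeta (2 * \<xi>) * fps_nth G (n - 2 * \<xi>))"
    by (rule sum_even_atMost)
  finally show ?thesis by (simp add: sum_distrib_left mult.assoc)
qed

text \<open>
  The sum over all integers \<open>x\<close> other than the poles of \<open>(x - p)\<^sup>-\<^sup>a (x - q)\<^sup>-\<^sup>b (x - r)\<^sup>-\<^sup>c\<close>: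
  expanding at each pole, the coefficient of \<open>t\<close> to the power \<open>- 2 \<xi>\<close> is weighted by \<open>2 \<zeta>(2 \<xi>)\<close>;
  the weight \<open>-1\<close> at \<open>\<xi> = 0\<close> accounts for the excluded poles.
\<close>
definition polar :: "real \<Rightarrow> real \<Rightarrow> real \<Rightarrow> nat \<Rightarrow> nat \<Rightarrow> nat \<Rightarrow> real" where
  "polar p q r a b c =
     fps_nth (zeta_even_fps * (fps_inv_lin (p - q) ^ b * fps_inv_lin (p - r) ^ c)) a
   + fps_nth (zeta_even_fps * (fps_inv_lin (q - p) ^ a * fps_inv_lin (q - r) ^ c)) b
   + fps_nth (zeta_even_fps * (fps_inv_lin (r - p) ^ a * fps_inv_lin (r - q) ^ b)) c"

lemma polar_commute12: "polar q p r b a c = polar p q r a b c"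
  by (simp add: polar_def mult.commute)

lemma polar_commute23: "polar p r q a c b = polar p q r a b c"
  by (simp add: polar_def mult.commute)

text \<open>At each expansion point \<open>p - q\<close> is the local form of
  \<open>(x - q) - (x - p)\<close>. A linear factor that is nonzero there cancels one inverse
  factor; a factor vanishing there is \<open>fps_X\<close> and shifts the coefficient index,
  lowering the order of that pole.\<close>

lemma polar_rec:
  assumes "p \<noteq> q" "p \<noteq> r" "q \<noteq> r"
  shows "(p - q) * polar p q r (Suc a) (Suc b) c
         = polar p q r (Suc a) b c - polar p q r a (Suc b) c"
proof -
  let ?E = "fps_inv_lin :: real \<Rightarrow> real fps"
  let ?u = "fps_const (p - q)"
  have 1: "?u * (zeta_even_fps * (?E (p - q) ^ Suc b * ?E (p - r) ^ c))
     = zeta_even_fps * (?E (p - q) ^ b * ?E (p - r) ^ c)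
       - fps_X * (zeta_even_fps * (?E (p - q) ^ Suc b * ?E (p - r) ^ c))"
  proof -
    have *: "?E (p - q) ^ b = (fps_X + ?u) * ?E (p - q) ^ Suc b"
      using fps_inv_lin_power_Suc [of "p - q" b] assms by simp
    show ?thesis unfolding * by (simp only: algebra_simps)
  qed
  have 2: "?u * (zeta_even_fps * (?E (q - p) ^ Suc a * ?E (q - r) ^ c))
     = fps_X * (zeta_even_fps * (?E (q - p) ^ Suc a * ?E (q - r) ^ c))
       - zeta_even_fps * (?E (q - p) ^ a * ?E (q - r) ^ c)"
  proof -
    have "?E (q - p) ^ a = (fps_X + fps_const (q - p)) * ?E (q - p) ^ Suc a"
      using fps_inv_lin_power_Suc [of "q - p" a] assms by simp
    moreover have "fps_const (q - p) = - ?u" by simp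
    ultimately have *: "?E (q - p) ^ a = (fps_X - ?u) * ?E (q - p) ^ Suc a"
      by (metis diff_conv_add_uminus)
    show ?thesis unfolding * by (simp only: algebra_simps)
  qed
  have 3: "?u * (zeta_even_fps * (?E (r - p) ^ Suc a * ?E (r - q) ^ Suc b))
     = zeta_even_fps * (?E (r - p) ^ Suc a * ?E (r - q) ^ b)
       - zeta_even_fps * (?E (r - p) ^ a * ?E (r - q) ^ Suc b)"
  proof -
    have a: "?E (r - p) ^ a = (fps_X + fps_const (r - p)) * ?E (r - p) ^ Suc a"
      using fps_inv_lin_power_Suc [of "r - p" a] assms by simp
    have b: "?E (r - q) ^ b = (fps_X + fps_const (r - q)) * ?E (r - q) ^ Suc b"
      using fps_inv_lin_power_Suc [of "r - q" b] assms by simp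
    have "?u = fps_const (r - q) - fps_const (r - p)" by simp
    thus ?thesis unfolding a b by (simp only:) (simp add: algebra_simps del: fps_const_sub)
  qed
  have nth1: "(p - q) * fps_nth F k = fps_nth (?u * F) k" for F k by simp
  show ?thesis
    unfolding polar_def distrib_left nth1 1 2 3 by simp
qed

text \<open>At \<open>q\<close> and \<open>r\<close> only the constant coefficient is read off, with
  weight -1. These terms remove the values at the excluded points from the full sum over
  \<open>p\<close>-shifted powers.\<close>

lemma polar_single:
  assumes "p \<noteq> q" "p \<noteq> r"
  shows "polar p q r a 0 0 = (if even a then 2 * rzeta a else 0) - 1 / (q - p) ^ a - 1 / (r - p) ^ a"
  using assms unfolding polar_def
  by (simp add: fps_nth_inv_lin_power zeta_even_fps_def rzeta_def)

text \<open>
  Symmetric partial sums are needed because a single simple pole gives only a conditionally convergent sum.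
\<close>
definition sym_sums :: "(int \<Rightarrow> real) \<Rightarrow> real \<Rightarrow> bool" where
  "sym_sums f L \<longleftrightarrow> (\<lambda>N. \<Sum>x=- int N..int N. f x) \<longlonglongrightarrow> L"

section \<open>Limits of symmetric partial sums and their behaviour under shifts\<close>

lemma sym_sums_diff: "sym_sums f K \<Longrightarrow> sym_sums g L \<Longrightarrow> sym_sums (\<lambda>x. f x - g x) (K - L)"
  unfolding sym_sums_def sum_subtractf by (rule tendsto_diff)

lemma sym_sums_cmult: "sym_sums f K \<Longrightarrow> sym_sums (\<lambda>x. c * f x) (c * K)"
  unfolding sym_sums_def sum_distrib_left [symmetric] by (rule tendsto_mult_left)

lemma sym_sums_single: "sym_sums (\<lambda>x. if x = p then v else 0) v"
  unfolding sym_sums_def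
proof (rule tendsto_eventually)
  show "\<forall>\<^sub>F N in sequentially. (\<Sum>x=- int N..int N. if x = p then v else 0) = v"
    using eventually_ge_at_top [of "nat \<bar>p\<bar>"] by eventually_elim auto
qed

lemma symmetric_interval_Suc:
  "{- int (Suc N)..int (Suc N)} = insert (- int (Suc N)) (insert (int (Suc N)) {- int N..int N})"
  by auto

lemma sum_shift_int:
  "(\<Sum>x=- int N..int N. f (x - 1)) = (\<Sum>x=- int N..int N. f x) + f (- int N - 1) - (f (int N) :: real)"
proof (induction N)
  case (Suc N)
  show ?case unfolding symmetric_interval_Suc
    using Suc.IH by (simp add: algebra_simps add.commute [of "- 1"] minus_diff_commute)
qed simp

lemma inverse_power_tendsto_int:
  assumes "a \<ge> (1::nat)" and g: "\<And>N. g N = int N + p \<or> g N = - (int N + p)"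
  shows "(\<lambda>N. 1 / real_of_int (g N) ^ a) \<longlonglongrightarrow> 0"
proof (rule tendsto_rabs_zero_cancel)
  have "(\<lambda>N. inverse (real N + of_int p)) \<longlonglongrightarrow> 0" by real_asymp
  hence "(\<lambda>N. \<bar>inverse (real N + of_int p) ^ a\<bar>) \<longlonglongrightarrow> \<bar>0 ^ a\<bar>"
    by (intro tendsto_rabs tendsto_power)
  moreover have "\<bar>inverse (real N + of_int p) ^ a\<bar> = \<bar>1 / real_of_int (g N) ^ a\<bar>" for N
  proof -
    have "\<bar>real_of_int (g N)\<bar> = \<bar>real N + of_int p\<bar>" using g [of N] by auto
    thus ?thesis by (simp add: power_abs abs_inverse inverse_eq_divide power_one_over)
  qed
  ultimately show "(\<lambda>N. \<bar>1 / real_of_int (g N) ^ a\<bar>) \<longlonglongrightarrow> 0"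
    using assms by (simp add: power_0_left)
qed

text \<open>A shift by one changes each symmetric partial sum only by two boundary terms, which tend
  to 0.\<close>

lemma sym_sums_shift_aux:
  assumes "sym_sums f L" "(\<lambda>N. f (int N)) \<longlonglongrightarrow> 0" "(\<lambda>N. f (- int N - 1)) \<longlonglongrightarrow> 0"
  shows "sym_sums (\<lambda>x. f (x - 1)) L"
proof -
  have "(\<lambda>N. (\<Sum>x=- int N..int N. f x) + f (- int N - 1) - f (int N)) \<longlonglongrightarrow> L + 0 - 0"
    using assms unfolding sym_sums_def by (intro tendsto_intros)
  thus ?thesis by (simp add: sym_sums_def sum_shift_int)
qed

lemma sym_sums_unshift_aux:
  assumes "sym_sums (\<lambda>x. f (x - 1)) L" "(\<lambda>N. f (int N)) \<longlonglongrightarrow> 0" "(\<lambda>N. f (- int N - 1)) \<longlonglongrightarrow> 0"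
  shows "sym_sums f L"
proof -
  have "(\<lambda>N. (\<Sum>x=- int N..int N. f (x - 1)) - f (- int N - 1) + f (int N)) \<longlonglongrightarrow> L - 0 + 0"
    using assms unfolding sym_sums_def by (intro tendsto_intros)
  thus ?thesis by (simp add: sym_sums_def sum_shift_int)
qed

text \<open>The terms at \<open>x\<close> and \<open>- x\<close> cancel for odd \<open>a\<close> and
  coincide for even \<open>a\<close>; the term at 0 is 0 because \<open>1 / 0 = 0\<close>. In
  particular \<open>a = 1\<close> cancels identically, so no divergent series arises.\<close>

lemma sym_sums_inverse_power_0:
  assumes "a \<ge> 1"
  shows "sym_sums (\<lambda>x. 1 / of_int x ^ a) (if even a then 2 * rzeta a else 0)"
proof -
  have part: "(\<Sum>x=- int N..int N. 1 / real_of_int x ^ a)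
      = (if even a then 2 * (\<Sum>k<N. 1 / real (Suc k) ^ a) else 0)" for N
  proof (induction N)
    case 0
    show ?case using assms by (simp add: power_0_left)
  next
    case (Suc N)
    have "(\<Sum>x=- int (Suc N)..int (Suc N). 1 / real_of_int x ^ a)
        = 1 / (- real (Suc N)) ^ a + (1 / real (Suc N) ^ a + (\<Sum>x=- int N..int N. 1 / real_of_int x ^ a))"
      unfolding symmetric_interval_Suc by (subst sum.insert; simp)+
    moreover have "(- real (Suc N)) ^ a = (if even a then real (Suc N) ^ a else - (real (Suc N) ^ a))"
      by (metis power_minus_even power_minus_odd)
    ultimately show ?case using Suc.IH by (simp only: sum.lessThan_Suc) (simp add: algebra_simps)
  qed
  show ?thesis
  proof (cases "even a")
    case True
    with assms have "a \<ge> 2" by (cases "a = 1") auto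
    hence "summable (\<lambda>k. inverse (real (Suc k) ^ a))"
      by (subst summable_Suc_iff) (rule inverse_power_summable)
    hence "(\<lambda>N. \<Sum>k<N. 1 / real (Suc k) ^ a) \<longlonglongrightarrow> (\<Sum>k. 1 / real (Suc k) ^ a)"
      by (intro summable_LIMSEQ) (simp add: field_simps)
    hence "(\<lambda>N. 2 * (\<Sum>k<N. 1 / real (Suc k) ^ a)) \<longlonglongrightarrow> 2 * (\<Sum>k. 1 / real (Suc k) ^ a)"
      by (rule tendsto_mult_left)
    thus ?thesis using True assms by (simp add: sym_sums_def part rzeta_def)
  next
    case False
    thus ?thesis by (simp add: sym_sums_def part)
  qed
qed

text \<open>Two-sided induction on \<open>p\<close> by unit shifts. Absolute convergence fails for
  \<open>a = 1\<close>, so translation invariance has to come from the vanishing of the boundary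
  terms.\<close>

lemma sym_sums_inverse_power:
  assumes "a \<ge> 1"
  shows "sym_sums (\<lambda>x. 1 / of_int (x - p) ^ a) (if even a then 2 * rzeta a else 0)"
proof (induction p rule: int_induct [where k = 0])
  case base
  show ?case using sym_sums_inverse_power_0 [OF assms] by simp
next
  case (step1 p)
  have "sym_sums (\<lambda>x. 1 / of_int (x - 1 - p) ^ a) (if even a then 2 * rzeta a else 0)"
    by (intro sym_sums_shift_aux [OF step1(2)] inverse_power_tendsto_int [OF assms, of _ "- p"]
          inverse_power_tendsto_int [OF assms, of _ "p + 1"]) auto
  thus ?case by (simp only: diff_diff_eq add.commute)
next
  case (step2 p)
  have "sym_sums (\<lambda>x. 1 / of_int ((x - 1) - (p - 1)) ^ a) (if even a then 2 * rzeta a else 0)"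
    using step2(2) by simp
  thus ?case
    by (rule sym_sums_unshift_aux [where f = "\<lambda>x. 1 / of_int (x - (p - 1)) ^ a"])
       (intro inverse_power_tendsto_int [OF assms, of _ "1 - p"]
          inverse_power_tendsto_int [OF assms, of _ p]; auto)+
qed

text \<open>All three points are omitted even when an exponent is 0. This lets the recurrence in the
  exponents hold at every \<open>x\<close> and agrees with the weight -1 at index 0 in
  \<open>polar\<close>.\<close>

definition recip3 :: "int \<Rightarrow> int \<Rightarrow> int \<Rightarrow> nat \<Rightarrow> nat \<Rightarrow> nat \<Rightarrow> int \<Rightarrow> real" where
  "recip3 p q r a b c x = (if x \<in> {p, q, r} then 0
     else 1 / (of_int (x - p) ^ a * of_int (x - q) ^ b * of_int (x - r) ^ c))"

lemma recip3_commute12: "recip3 q p r b a c = recip3 p q r a b c"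
  by (auto simp: recip3_def fun_eq_iff)

lemma recip3_commute23: "recip3 p r q a c b = recip3 p q r a b c"
  by (auto simp: recip3_def fun_eq_iff)

text \<open>
  Both sides obey the recurrence coming from \<open>(x - q) - (x - p) = p - q\<close>, which reduces everything to
  a single pole; no explicit partial fraction expansion is needed.
\<close>
lemma sym_sums_recip3_step:
  assumes "p \<noteq> q" "p \<noteq> r" "q \<noteq> r"
    and "sym_sums (recip3 p q r (Suc a) b c) (polar p q r (Suc a) b c)"
    and "sym_sums (recip3 p q r a (Suc b) c) (polar p q r a (Suc b) c)"
  shows "sym_sums (recip3 p q r (Suc a) (Suc b) c) (polar p q r (Suc a) (Suc b) c)"
proof -
  let ?d = "real_of_int (p - q)"
  have d: "?d \<noteq> 0" using assms(1) by simp
  have rec: "recip3 p q r (Suc a) b c x - recip3 p q r a (Suc b) c x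
        = ?d * recip3 p q r (Suc a) (Suc b) c x" for x
  proof (cases "x \<in> {p, q, r}")
    case False
    hence "real_of_int (x - p) \<noteq> 0" "real_of_int (x - q) \<noteq> 0" "real_of_int (x - r) \<noteq> 0" by auto
    moreover have "?d = real_of_int (x - q) - real_of_int (x - p)" by simp
    ultimately show ?thesis using False unfolding recip3_def
      by (simp add: divide_simps del: of_int_diff)
  qed (auto simp: recip3_def)
  have "sym_sums (\<lambda>x. ?d * recip3 p q r (Suc a) (Suc b) c x)
      (polar p q r (Suc a) b c - polar p q r a (Suc b) c)"
    unfolding rec [symmetric] by (rule sym_sums_diff [OF assms(4,5)])
  also have "polar p q r (Suc a) b c - polar p q r a (Suc b) c = ?d * polar p q r (Suc a) (Suc b) c"
    using assms by (subst polar_rec [symmetric]) auto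
  finally have "sym_sums (\<lambda>x. 1 / ?d * (?d * recip3 p q r (Suc a) (Suc b) c x))
      (1 / ?d * (?d * polar p q r (Suc a) (Suc b) c))"
    by (rule sym_sums_cmult)
  thus ?thesis using d by simp
qed

lemma sym_sums_recip3_single:
  assumes "p \<noteq> q" "p \<noteq> r" "q \<noteq> r" "a \<ge> 1"
  shows "sym_sums (recip3 p q r a 0 0) (polar p q r a 0 0)"
proof -
  have "recip3 p q r a 0 0 = (\<lambda>x. 1 / of_int (x - p) ^ a - (if x = q then 1 / of_int (q - p) ^ a else 0)
      - (if x = r then 1 / of_int (r - p) ^ a else 0))"
    using assms by (auto simp: recip3_def fun_eq_iff power_0_left)
  moreover have "polar p q r a 0 0 = (if even a then 2 * rzeta a else 0)
      - 1 / of_int (q - p) ^ a - 1 / of_int (r - p) ^ a"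
    using assms by (subst polar_single) auto
  ultimately show ?thesis using assms
    by (simp only:) (intro sym_sums_diff sym_sums_single sym_sums_inverse_power)
qed

text \<open>Induction on the total exponent. If two exponents are positive, the recurrence lowers
  one of them and keeps the other, so the total stays positive; the commutation lemmas bring any
  such pair to the front. Otherwise a single pole is left.\<close>

lemma sym_sums_recip3:
  assumes "p \<noteq> q" "p \<noteq> r" "q \<noteq> r" "a + b + c \<ge> 1"
  shows "sym_sums (recip3 p q r a b c) (polar p q r a b c)"
  using assms
proof (induction "a + b + c" arbitrary: p q r a b c rule: less_induct)
  case less
  note IH = less(1)
  consider (ab) a' b' where "a = Suc a'" "b = Suc b'" | (ac) a' c' where "a = Suc a'" "c = Suc c'"
    | (bc) b' c' where "b = Suc b'" "c = Suc c'" | (a) "b = 0" "c = 0" "a \<ge> 1"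
    | (b) "a = 0" "c = 0" "b \<ge> 1" | (c) "a = 0" "b = 0" "c \<ge> 1"
    using less.prems(4) by (cases a; cases b; cases c) auto
  thus ?case
  proof cases
    case ab
    show ?thesis unfolding ab using less.prems
      by (intro sym_sums_recip3_step IH) (auto simp: ab)
  next
    case ac
    have "sym_sums (recip3 p r q (Suc a') (Suc c') b) (polar p r q (Suc a') (Suc c') b)"
      using less.prems by (intro sym_sums_recip3_step IH) (auto simp: ac)
    thus ?thesis by (simp only: ac recip3_commute23 polar_commute23)
  next
    case bc
    have "sym_sums (recip3 q r p (Suc b') (Suc c') a) (polar q r p (Suc b') (Suc c') a)"
      using less.prems by (intro sym_sums_recip3_step IH) (auto simp: bc)
    thus ?thesis
      by (simp only: bc recip3_commute23 [of q p r] polar_commute23 [of q p r]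
          recip3_commute12 [of p q] polar_commute12 [of p q])
  next
    case a
    thus ?thesis using sym_sums_recip3_single [of p q r a] less.prems by simp
  next
    case b
    thus ?thesis using sym_sums_recip3_single [of q p r b] less.prems
      by (simp add: recip3_commute12 [of p q] polar_commute12 [of p q])
  next
    case c
    thus ?thesis using sym_sums_recip3_single [of r p q c] less.prems
      by (simp add: recip3_commute12 [of p r] polar_commute12 [of p r]
          recip3_commute23 [of p q] polar_commute23 [of p q])
  qed
qed

subsection \<open>Partial fractions and double zeta values\<close>

text \<open>With \<open>\<alpha> = 1 / x\<close> and \<open>\<kappa> = 1 / (x + y)\<close> these are
  the terms in powers of \<open>1 / x\<close> of the partial fraction expansion of
  \<open>1 / (x^(a+1) y^(c+1))\<close>; both exponents are shifted by one.\<close>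

definition pfrac_part :: "'a::comm_ring_1 \<Rightarrow> 'a \<Rightarrow> nat \<Rightarrow> nat \<Rightarrow> 'a" where
  "pfrac_part \<kappa> \<alpha> a c =
     (\<Sum>\<omega>=0..a. of_nat ((a - \<omega> + c) choose c) * \<kappa> ^ (a - \<omega> + c + 1) * \<alpha> ^ Suc \<omega>)"

lemma pfrac_part_0_Suc: "pfrac_part \<kappa> \<alpha> 0 (Suc c) = \<kappa> * pfrac_part \<kappa> \<alpha> 0 c"
  by (simp add: pfrac_part_def algebra_simps)

lemma pfrac_part_Suc_0:
  "pfrac_part \<kappa> \<alpha> (Suc a) 0 = \<kappa> * (pfrac_part \<kappa> \<alpha> a 0 + \<alpha> ^ Suc (Suc a))"
proof -
  have "pfrac_part \<kappa> \<alpha> (Suc a) 0 = (\<Sum>\<omega>=0..a. \<kappa> ^ (Suc a - \<omega> + 1) * \<alpha> ^ Suc \<omega>) + \<kappa> * \<alpha> ^ Suc (Suc a)"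
    by (simp add: pfrac_part_def)
  also have "(\<Sum>\<omega>=0..a. \<kappa> ^ (Suc a - \<omega> + 1) * \<alpha> ^ Suc \<omega>) = \<kappa> * pfrac_part \<kappa> \<alpha> a 0"
    unfolding pfrac_part_def sum_distrib_left
    by (intro sum.cong refl) (simp add: Suc_diff_le mult_ac)
  finally show ?thesis by (simp only: distrib_left)
qed

text \<open>Pascal's rule, term by term. The last index \<open>\<omega> = Suc a\<close> is split off
  because it occurs only in the first summand on the right.\<close>

lemma pfrac_part_Suc_Suc:
  "pfrac_part \<kappa> \<alpha> (Suc a) (Suc c) = \<kappa> * (pfrac_part \<kappa> \<alpha> (Suc a) c + pfrac_part \<kappa> \<alpha> a (Suc c))"
proof -
  have "pfrac_part \<kappa> \<alpha> (Suc a) (Suc c)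
      = (\<Sum>\<omega>=0..a. of_nat ((Suc a - \<omega> + Suc c) choose Suc c) * \<kappa> ^ (Suc a - \<omega> + Suc c + 1) * \<alpha> ^ Suc \<omega>)
        + \<kappa> ^ (c + 2) * \<alpha> ^ Suc (Suc a)"
    by (simp add: pfrac_part_def del: binomial_Suc_Suc)
  also have "(\<Sum>\<omega>=0..a. of_nat ((Suc a - \<omega> + Suc c) choose Suc c) * \<kappa> ^ (Suc a - \<omega> + Suc c + 1) * \<alpha> ^ Suc \<omega>)
      = \<kappa> * ((\<Sum>\<omega>=0..a. of_nat ((Suc a - \<omega> + c) choose c) * \<kappa> ^ (Suc a - \<omega> + c + 1) * \<alpha> ^ Suc \<omega>)
        + pfrac_part \<kappa> \<alpha> a (Suc c))"
    unfolding pfrac_part_def sum_distrib_left sum.distrib [symmetric]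
  proof (intro sum.cong refl)
    fix \<omega> assume "\<omega> \<in> {0..a}"
    then obtain k where k: "a = \<omega> + k" by (auto simp: le_iff_add)
    have "(Suc k + Suc c) choose Suc c = ((Suc k + c) choose c) + ((k + Suc c) choose Suc c)"
      by simp
    thus "of_nat ((Suc a - \<omega> + Suc c) choose Suc c) * \<kappa> ^ (Suc a - \<omega> + Suc c + 1) * \<alpha> ^ Suc \<omega> =
      \<kappa> * (of_nat ((Suc a - \<omega> + c) choose c) * \<kappa> ^ (Suc a - \<omega> + c + 1) * \<alpha> ^ Suc \<omega> +
         of_nat ((a - \<omega> + Suc c) choose Suc c) * \<kappa> ^ (a - \<omega> + Suc c + 1) * \<alpha> ^ Suc \<omega>)"
      by (simp add: k algebra_simps)
  qed
  also have "\<dots> + \<kappa> ^ (c + 2) * \<alpha> ^ Suc (Suc a) = \<kappa> * (pfrac_part \<kappa> \<alpha> (Suc a) c + pfrac_part \<kappa> \<alpha> a (Suc c))"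
    by (simp add: pfrac_part_def [of _ _ "Suc a" c] algebra_simps)
  finally show ?thesis .
qed

text \<open>The hypothesis is \<open>1 / (x y) = (1 / (x + y)) (1 / x + 1 / y)\<close> in terms of
  the inverses. Applying it once lowers one of the two exponents, and \<open>pfrac_part\<close>
  obeys the same recurrence. A general commutative ring allows \<alpha> and \<beta> to be power
  series.\<close>

lemma partial_fractions:
  fixes \<alpha> \<beta> :: "'a::comm_ring_1"
  assumes "\<alpha> * \<beta> = \<kappa> * (\<alpha> + \<beta>)"
  shows "\<alpha> ^ Suc a * \<beta> ^ Suc c = pfrac_part \<kappa> \<alpha> a c + pfrac_part \<kappa> \<beta> c a"
proof -
  have split: "\<alpha> ^ Suc i * \<beta> ^ Suc j = \<kappa> * (\<alpha> ^ Suc i * \<beta> ^ j + \<alpha> ^ i * \<beta> ^ Suc j)" for i j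
  proof -
    have "\<alpha> ^ Suc i * \<beta> ^ Suc j = (\<alpha> * \<beta>) * (\<alpha> ^ i * \<beta> ^ j)" by (simp add: mult_ac)
    thus ?thesis unfolding assms by (simp add: algebra_simps)
  qed
  show ?thesis
  proof (induction a arbitrary: c)
    case 0
    show ?case
    proof (induction c)
      case 0
      show ?case using assms by (simp add: pfrac_part_def algebra_simps)
    next
      case (Suc c)
      show ?case
        using Suc by (subst split) (simp add: pfrac_part_0_Suc pfrac_part_Suc_0 algebra_simps)
    qed
  next
    case (Suc a)
    note outer = this
    show ?case
    proof (induction c)
      case 0
      show ?case
        using outer [of 0] by (subst split) (simp add: pfrac_part_0_Suc pfrac_part_Suc_0 algebra_simps)
    next
      case (Suc c)
      show ?case
        unfolding split [of "Suc a" "Suc c"] Suc.IH outer pfrac_part_Suc_Suc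
        by (simp only: algebra_simps)
    qed
  qed
qed

lemma fps_nth_pfrac_part:
  assumes "\<And>k. fps_nth (\<alpha> ^ Suc k) B = f k"
  shows "fps_nth (pfrac_part (fps_const \<kappa>) \<alpha> a c) B =
    (\<Sum>\<omega>=0..a. of_nat ((a - \<omega> + c) choose c) * \<kappa> ^ (a - \<omega> + c + 1) * (f \<omega> :: 'a :: field))"
proof -
  have "fps_nth (of_nat n * fps_const \<kappa> ^ i * \<alpha> ^ Suc k) B = of_nat n * \<kappa> ^ i * f k" for n i k
    unfolding assms [symmetric] fps_of_nat [symmetric] fps_const_power fps_const_mult
    by (rule fps_mult_left_const_nth)
  thus ?thesis unfolding pfrac_part_def fps_sum_nth by (simp only:)
qed

text \<open>Expansion at the middle pole 0: the factors \<open>m + t\<close> and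
  \<open>n - t\<close> have the constant sum \<open>m + n\<close>, so
  \<open>partial_fractions\<close> applies to their inverses with constant \<kappa>. The sign
  \<open>(-1) ^ c\<close> turns \<open>t - n\<close> into \<open>n - t\<close>.\<close>

lemma fps_nth_inv_lin_mult:
  fixes m n :: real
  assumes "m > 0" "n > 0" "a \<ge> 1" "c \<ge> 1"
  shows "(-1) ^ c * fps_nth (fps_inv_lin m ^ a * fps_inv_lin (- n) ^ c) B =
    (-1) ^ B * (\<Sum>\<omega>=0..a - 1. of_nat ((\<omega> + B) choose \<omega>) * of_nat ((a + c - \<omega> - 2) choose (c - 1))
         * (1 / (m ^ (B + \<omega> + 1) * (m + n) ^ (a + c - 1 - \<omega>))))
    + (\<Sum>\<omega>=0..c - 1. of_nat ((\<omega> + B) choose \<omega>) * of_nat ((a + c - \<omega> - 2) choose (a - 1))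
         * (1 / (n ^ (B + \<omega> + 1) * (m + n) ^ (a + c - 1 - \<omega>))))"
proof -
  obtain a' c' where ac: "a = Suc a'" "c = Suc c'"
    using assms(3,4) by (cases a; cases c) auto
  define \<alpha> where "\<alpha> = fps_inv_lin m"
  define \<beta> where "\<beta> = - fps_inv_lin (- n)"
  let ?\<kappa> = "fps_const (1 / (m + n))"
  have \<alpha>: "(fps_X + fps_const m) * \<alpha> = 1"
    unfolding \<alpha>_def using assms by (intro fps_inv_lin_mult) simp
  have "(fps_X + fps_const (- n)) * fps_inv_lin (- n) = 1"
    using assms by (intro fps_inv_lin_mult) simp
  hence \<beta>: "(fps_const n - fps_X) * \<beta> = 1"
    by (simp add: \<beta>_def algebra_simps flip: fps_const_neg)
  have "fps_const (m + n) * (\<alpha> * \<beta>) = ((fps_X + fps_const m) * \<alpha>) * \<beta> + ((fps_const n - fps_X) * \<beta>) * \<alpha>"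
    unfolding fps_const_add [symmetric] by (simp only: algebra_simps)
  hence "fps_const (m + n) * (\<alpha> * \<beta>) = \<alpha> + \<beta>"
    unfolding \<alpha> \<beta> by simp
  hence "?\<kappa> * (fps_const (m + n) * (\<alpha> * \<beta>)) = ?\<kappa> * (\<alpha> + \<beta>)" by simp
  moreover have "?\<kappa> * fps_const (m + n) = 1" using assms by simp
  ultimately have "\<alpha> * \<beta> = ?\<kappa> * (\<alpha> + \<beta>)" by (metis mult.assoc mult_1)
  note pf = partial_fractions [OF this, of a' c']
  have 1: "fps_nth (\<alpha> ^ Suc k) B = (-1) ^ B * of_nat ((k + B) choose k) / m ^ (B + k + 1)" for k
    unfolding \<alpha>_def using assms binomial_symmetric [of k "k + B"]
    by (subst fps_nth_inv_lin_power) (simp_all add: add_ac)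
  have 2: "fps_nth (\<beta> ^ Suc k) B = of_nat ((k + B) choose k) / n ^ (B + k + 1)" for k
  proof -
    have "\<beta> ^ Suc k = fps_const ((-1) ^ Suc k) * fps_inv_lin (- n) ^ Suc k"
      unfolding \<beta>_def by (subst power_minus) (simp flip: fps_const_power fps_const_neg)
    hence "fps_nth (\<beta> ^ Suc k) B = (-1) ^ Suc k * fps_nth (fps_inv_lin (- n) ^ Suc k) B"
      by (metis fps_mult_left_const_nth)
    also have "\<dots> = (-1) ^ Suc k * ((-1) ^ B * of_nat ((k + B) choose k) / (- n) ^ (B + k + 1))"
      using assms binomial_symmetric [of k "k + B"]
      by (subst fps_nth_inv_lin_power) (simp_all add: add_ac)
    also have "(- n) ^ (B + k + 1) = (-1) ^ Suc k * (-1) ^ B * n ^ (B + k + 1)"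
      by (subst power_minus) (simp add: power_add)
    finally show ?thesis by (cases "even k"; cases "even B") simp_all
  qed
  have "(-1) ^ c * fps_nth (fps_inv_lin m ^ a * fps_inv_lin (- n) ^ c) B
      = fps_nth (\<alpha> ^ Suc a' * \<beta> ^ Suc c') B"
  proof -
    have "\<alpha> ^ Suc a' * \<beta> ^ Suc c' = fps_const ((-1) ^ c) * (fps_inv_lin m ^ a * fps_inv_lin (- n) ^ c)"
      unfolding \<alpha>_def \<beta>_def ac by (subst power_minus) (simp flip: fps_const_power fps_const_neg add: mult_ac)
    thus ?thesis by (metis fps_mult_left_const_nth)
  qed
  also have "\<dots> = fps_nth (pfrac_part ?\<kappa> \<alpha> a' c') B + fps_nth (pfrac_part ?\<kappa> \<beta> c' a') B"
    unfolding pf by simp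
  also have "fps_nth (pfrac_part ?\<kappa> \<alpha> a' c') B = (-1) ^ B * (\<Sum>\<omega>=0..a - 1. of_nat ((\<omega> + B) choose \<omega>)
         * of_nat ((a + c - \<omega> - 2) choose (c - 1)) * (1 / (m ^ (B + \<omega> + 1) * (m + n) ^ (a + c - 1 - \<omega>))))"
    unfolding fps_nth_pfrac_part [OF 1] sum_distrib_left
    by (intro sum.cong) (auto simp: ac power_one_over Suc_diff_le add.commute mult_ac)
  also have "fps_nth (pfrac_part ?\<kappa> \<beta> c' a') B = (\<Sum>\<omega>=0..c - 1. of_nat ((\<omega> + B) choose \<omega>)
         * of_nat ((a + c - \<omega> - 2) choose (a - 1)) * (1 / (n ^ (B + \<omega> + 1) * (m + n) ^ (a + c - 1 - \<omega>))))"
    unfolding fps_nth_pfrac_part [OF 2]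
    by (intro sum.cong) (auto simp: ac power_one_over Suc_diff_le add.commute mult_ac)
  finally show ?thesis .
qed

section \<open>Double zeta values as absolutely convergent sums over pairs of gaps\<close>

lemma summable_on_product_nonneg:
  fixes f :: "'a \<Rightarrow> real" and g :: "'b \<Rightarrow> real"
  assumes "f summable_on A" "g summable_on B" "\<And>x. x \<in> A \<Longrightarrow> f x \<ge> 0" "\<And>y. y \<in> B \<Longrightarrow> g y \<ge> 0"
  shows "(\<lambda>(x, y). f x * g y) summable_on A \<times> B"
proof (rule summable_on_SigmaI)
  show "((\<lambda>y. case (x, y) of (x, y) \<Rightarrow> f x * g y) has_sum f x * infsum g B) B" for x
    using assms(2) by (auto intro!: has_sum_cmult_right)
  show "(\<lambda>x. f x * infsum g B) summable_on A"
    by (intro summable_on_cmult_left assms)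
qed (simp add: assms(3,4))

text \<open>In the extreme case \<open>i = 1\<close>, \<open>j = 2\<close>, writing
  \<open>(m + n)^2\<close> as \<open>(m + n)^(1/2) (m + n)^(3/2)\<close> and bounding the factors
  below by \<open>m^(1/2)\<close> and \<open>n^(3/2)\<close> gives a product majorant with both
  exponents \<open>3/2 > 1\<close>.\<close>

lemma mzv2_summable:
  assumes "i \<ge> 1" "j \<ge> 2"
  shows "(\<lambda>(m, n). 1 / (real m ^ i * real (m + n) ^ j)) summable_on {(m, n). 0 < m \<and> 0 < n}"
proof (rule summable_on_comparison_test)
  have "summable (\<lambda>n. real n powr (-3/2))" by (subst summable_real_powr_iff) simp
  hence "(\<lambda>n. real n powr (-3/2)) summable_on UNIV"
    by (rule summable_nonneg_imp_summable_on) simp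
  hence "(\<lambda>(m, n). real m powr (-3/2) * real n powr (-3/2)) summable_on UNIV \<times> UNIV"
    by (intro summable_on_product_nonneg) auto
  thus "(\<lambda>(m, n). real m powr (-3/2) * real n powr (-3/2)) summable_on {(m, n). 0 < m \<and> 0 < n}"
    by (rule summable_on_subset_banach) auto
next
  fix x :: "nat \<times> nat" assume "x \<in> {(m, n). 0 < m \<and> 0 < n}"
  then obtain m n where x: "x = (m, n)" "m \<ge> 1" "n \<ge> 1" by (cases x) auto
  have "real m powr (3/2) * real n powr (3/2) = (real m * real m powr (1/2)) * real n powr (3/2)"
    using x powr_add [of "real m" 1 "1/2"] by simp
  also have "\<dots> \<le> (real m * real (m + n) powr (1/2)) * real (m + n) powr (3/2)"
    by (intro mult_mono powr_mono2) auto
  also have "\<dots> = real m * (real (m + n) powr (1/2) * real (m + n) powr (3/2))"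
    by simp
  also have "real (m + n) powr (1/2) * real (m + n) powr (3/2) = real (m + n) ^ 2"
    unfolding powr_add [symmetric] using x powr_realpow [of "real (m + n)" 2] by simp
  also have "real m * real (m + n) ^ 2 \<le> real m ^ i * real (m + n) ^ j"
    using x assms power_increasing [of 1 i "real m"]
    by (intro mult_mono power_increasing) auto
  finally have "1 / (real m ^ i * real (m + n) ^ j) \<le> 1 / (real m powr (3/2) * real n powr (3/2))"
    using x by (intro divide_left_mono mult_pos_pos) auto
  also have "\<dots> = real m powr (-3/2) * real n powr (-3/2)"
    using x by (simp add: powr_minus_divide)
  finally show "(case x of (m, n) \<Rightarrow> 1 / (real m ^ i * real (m + n) ^ j))
      \<le> (case x of (m, n) \<Rightarrow> real m powr (-3/2) * real n powr (-3/2))"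
    using x by simp
qed auto

lemma has_sum_mzv2:
  assumes "i \<ge> 1" "j \<ge> 2"
  shows "((\<lambda>(m, n). 1 / (real m ^ i * real (m + n) ^ j)) has_sum mzv2 i j) {(m, n). 0 < m \<and> 0 < n}"
proof -
  let ?f = "\<lambda>(m, n). 1 / (real m ^ i * real (m + n) ^ j)"
  have "infsum ?f {(m, n). 0 < m \<and> 0 < n} = mzv2 i j"
    unfolding mzv2_def
    by (intro infsum_reindex_bij_witness [of _ "\<lambda>(x, y). (x, y - x)" "\<lambda>(m, n). (m, m + n)"]) auto
  thus ?thesis using has_sum_infsum [OF mzv2_summable [OF assms]] by simp
qed

lemma has_sum_mzv2_flip:
  assumes "i \<ge> 1" "j \<ge> 2"
  shows "((\<lambda>(m, n). 1 / (real n ^ i * real (m + n) ^ j)) has_sum mzv2 i j) {(m, n). 0 < m \<and> 0 < n}"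
    (is "(?g has_sum _) ?A")
proof -
  have "(?g has_sum mzv2 i j) ?A
      \<longleftrightarrow> ((\<lambda>(m, n). 1 / (real m ^ i * real (m + n) ^ j)) has_sum mzv2 i j) ?A"
    by (rule has_sum_reindex_bij_witness [of _ prod.swap prod.swap]) (auto simp: add.commute)
  thus ?thesis using has_sum_mzv2 [OF assms] by simp
qed

subsection \<open>Sums over ordered integer triples\<close>

lemma summable_on_inverse_power_nat:
  assumes "a \<ge> 2"
  shows "(\<lambda>n. 1 / real n ^ a) summable_on UNIV"
proof (rule summable_nonneg_imp_summable_on)
  show "summable (\<lambda>n. 1 / real n ^ a)"
    using inverse_power_summable [OF assms, where ?'a = real] by (simp add: inverse_eq_divide)
qed simp

lemma summable_on_triple_nat:
  assumes "s \<ge> 2" "t \<ge> 2" "u \<ge> 2"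
  shows "(\<lambda>(x, y, z). 1 / (real x ^ s * real y ^ t * real z ^ u)) summable_on A"
proof -
  have "(\<lambda>(x, y). (1 / real x ^ s) * (case y of (y, z) \<Rightarrow> (1 / real y ^ t) * (1 / real z ^ u)))
      summable_on UNIV \<times> (UNIV \<times> UNIV)"
    by (intro summable_on_product_nonneg summable_on_inverse_power_nat assms) auto
  hence "(\<lambda>(x, y). (1 / real x ^ s) * (case y of (y, z) \<Rightarrow> (1 / real y ^ t) * (1 / real z ^ u)))
      summable_on A"
    by (rule summable_on_subset_banach) auto
  thus ?thesis by (simp add: case_prod_unfold mult.assoc)
qed

lemma has_sum_mzv3:
  assumes "s \<ge> 2" "t \<ge> 2" "u \<ge> 2"
  shows "((\<lambda>(x, y, z). 1 / (real x ^ s * real y ^ t * real z ^ u)) has_sum mzv3 s t u)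
    {(x, y, z). 0 < x \<and> x < y \<and> y < z}"
  unfolding mzv3_def by (intro has_sum_infsum summable_on_triple_nat assms)

lemma has_sum_mzv2_ordered:
  assumes "i \<ge> 1" "j \<ge> 2"
  shows "((\<lambda>(x, y). 1 / (real x ^ i * real y ^ j)) has_sum mzv2 i j) {(x, y). 0 < x \<and> x < y}"
    (is "(?f has_sum _) ?A")
proof -
  have "(?f has_sum mzv2 i j) ?A
      \<longleftrightarrow> ((\<lambda>(m, n). 1 / (real m ^ i * real (m + n) ^ j)) has_sum mzv2 i j) {(m, n). 0 < m \<and> 0 < n}"
    by (rule has_sum_reindex_bij_witness [of _ "\<lambda>(m, n). (m, m + n)" "\<lambda>(x, y). (x, y - x)"]) auto
  thus ?thesis using has_sum_mzv2 [OF assms] by simp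
qed

text \<open>The free entry \<open>x\<close> lies below, between or above the chain
  \<open>y < z\<close>, or equals one of its members; the two equalities merge exponents and give
  the double zeta values.\<close>

lemma has_sum_stuffle:
  assumes "s \<ge> 2" "t \<ge> 2" "u \<ge> 2"
  shows "((\<lambda>(x, y, z). 1 / (real x ^ s * real y ^ t * real z ^ u)) has_sum
      (mzv3 s t u + mzv3 t s u + mzv3 t u s + mzv2 (s + t) u + mzv2 t (s + u)))
      {(x, y, z). 0 < x \<and> 0 < y \<and> y < z}"
proof -
  let ?f = "\<lambda>(x, y, z). 1 / (real x ^ s * real y ^ t * real z ^ u)"
  let ?A1 = "{(x, y, z). 0 < x \<and> x < y \<and> y < z} :: (nat \<times> nat \<times> nat) set"
  let ?A2 = "{(x, y, z). 0 < y \<and> y < x \<and> x < z} :: (nat \<times> nat \<times> nat) set"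
  let ?A3 = "{(x, y, z). 0 < y \<and> y < z \<and> z < x} :: (nat \<times> nat \<times> nat) set"
  let ?A4 = "{(x, y, z). 0 < x \<and> x = y \<and> y < z} :: (nat \<times> nat \<times> nat) set"
  let ?A5 = "{(x, y, z). 0 < y \<and> y < z \<and> x = z} :: (nat \<times> nat \<times> nat) set"
  have 1: "(?f has_sum mzv3 s t u) ?A1" by (rule has_sum_mzv3 [OF assms])
  have "(?f has_sum mzv3 t s u) ?A2 \<longleftrightarrow>
      ((\<lambda>(x, y, z). 1 / (real x ^ t * real y ^ s * real z ^ u)) has_sum mzv3 t s u) ?A1"
    by (rule has_sum_reindex_bij_witness [of _ "\<lambda>(y, x, z). (x, y, z)" "\<lambda>(x, y, z). (y, x, z)"])
       (auto simp: mult_ac)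
  hence 2: "(?f has_sum mzv3 t s u) ?A2" using has_sum_mzv3 assms by simp
  have "(?f has_sum mzv3 t u s) ?A3 \<longleftrightarrow>
      ((\<lambda>(x, y, z). 1 / (real x ^ t * real y ^ u * real z ^ s)) has_sum mzv3 t u s) ?A1"
    by (rule has_sum_reindex_bij_witness [of _ "\<lambda>(y, z, x). (x, y, z)" "\<lambda>(x, y, z). (y, z, x)"])
       (auto simp: mult_ac)
  hence 3: "(?f has_sum mzv3 t u s) ?A3" using has_sum_mzv3 assms by simp
  have "(?f has_sum mzv2 (s + t) u) ?A4 \<longleftrightarrow>
      ((\<lambda>(x, y). 1 / (real x ^ (s + t) * real y ^ u)) has_sum mzv2 (s + t) u) {(x, y). 0 < x \<and> x < y}"
    by (rule has_sum_reindex_bij_witness [of _ "\<lambda>(y, z). (y, y, z)" "\<lambda>(x, y, z). (y, z)"])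
       (auto simp: power_add)
  hence 4: "(?f has_sum mzv2 (s + t) u) ?A4" using has_sum_mzv2_ordered assms by simp
  have "(?f has_sum mzv2 t (s + u)) ?A5 \<longleftrightarrow>
      ((\<lambda>(x, y). 1 / (real x ^ t * real y ^ (s + u))) has_sum mzv2 t (s + u)) {(x, y). 0 < x \<and> x < y}"
    by (rule has_sum_reindex_bij_witness [of _ "\<lambda>(y, z). (z, y, z)" "\<lambda>(x, y, z). (y, z)"])
       (auto simp: power_add mult_ac)
  hence 5: "(?f has_sum mzv2 t (s + u)) ?A5" using has_sum_mzv2_ordered assms by simp
  have "(?f has_sum (mzv3 s t u + mzv3 t s u + mzv3 t u s + mzv2 (s + t) u + mzv2 t (s + u)))
      (?A1 \<union> ?A2 \<union> ?A3 \<union> ?A4 \<union> ?A5)"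
    by (intro has_sum_Un_disjoint 1 2 3 4 5) auto
  also have "?A1 \<union> ?A2 \<union> ?A3 \<union> ?A4 \<union> ?A5 = {(x, y, z). 0 < x \<and> 0 < y \<and> y < z}"
    by auto
  finally show ?thesis .
qed

text \<open>
  Triples with a zero entry contribute nothing because \<open>1 / 0 = 0\<close>; the others are split by the number
  of negative entries.
\<close>
lemma has_sum_ordered_int_triples:
  assumes "a \<ge> 2" "b \<ge> 2" "c \<ge> 2"
  shows "((\<lambda>(x, y, z). 1 / (real_of_int x ^ c * real_of_int y ^ b * real_of_int z ^ a)) has_sum
      (mzv3 c b a
       + (-1) ^ c * (mzv3 c b a + mzv3 b c a + mzv3 b a c + mzv2 (c + b) a + mzv2 b (c + a))
       + (-1) ^ (b + c) * (mzv3 a b c + mzv3 b a c + mzv3 b c a + mzv2 (a + b) c + mzv2 b (a + c))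
       + (-1) ^ (a + b + c) * mzv3 a b c))
      {(x, y, z). x < y \<and> y < z}"
    (is "(?h has_sum ?S) ?D")
proof -
  let ?C1 = "{(x, y, z). 0 < x \<and> x < y \<and> y < z} :: (int \<times> int \<times> int) set"
  let ?C2 = "{(x, y, z). x < 0 \<and> 0 < y \<and> y < z} :: (int \<times> int \<times> int) set"
  let ?C3 = "{(x, y, z). x < y \<and> y < 0 \<and> 0 < z} :: (int \<times> int \<times> int) set"
  let ?C4 = "{(x, y, z). x < y \<and> y < z \<and> z < 0} :: (int \<times> int \<times> int) set"
  let ?f = "\<lambda>s t u (x, y, z). 1 / (real x ^ s * real y ^ t * real z ^ u)"
  have "(?h has_sum mzv3 c b a) ?C1 \<longleftrightarrow> (?f c b a has_sum mzv3 c b a) {(x, y, z). 0 < x \<and> x < y \<and> y < z}"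
    by (rule has_sum_reindex_bij_witness
          [of _ "\<lambda>(x, y, z). (int x, int y, int z)" "\<lambda>(x, y, z). (nat x, nat y, nat z)"]) auto
  hence 1: "(?h has_sum mzv3 c b a) ?C1" using has_sum_mzv3 assms by simp
  have "(?h has_sum (-1) ^ c * T) ?C2 \<longleftrightarrow>
      ((\<lambda>x. (-1) ^ c * ?f c b a x) has_sum (-1) ^ c * T) {(x, y, z). 0 < x \<and> 0 < y \<and> y < z}" for T
    by (rule has_sum_reindex_bij_witness
          [of _ "\<lambda>(x, y, z). (- int x, int y, int z)" "\<lambda>(x, y, z). (nat (- x), nat y, nat z)"])
       (auto simp: power_minus [of "real_of_int _"] field_simps)
  hence 2: "(?h has_sum (-1) ^ c * (mzv3 c b a + mzv3 b c a + mzv3 b a c + mzv2 (c + b) a + mzv2 b (c + a))) ?C2"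
    using has_sum_cmult_right [OF has_sum_stuffle [of c b a]] assms by blast
  \<comment> \<open>Negation turns \<open>x < y < 0\<close> into the chain
    \<open>0 < - y < - x\<close> with exponents \<open>b\<close>, \<open>c\<close>, while the
    positive entry \<open>z\<close> with exponent \<open>a\<close> becomes the free one.\<close>
  have "(?h has_sum (-1) ^ (b + c) * T) ?C3 \<longleftrightarrow>
      ((\<lambda>x. (-1) ^ (b + c) * ?f a b c x) has_sum (-1) ^ (b + c) * T) {(x, y, z). 0 < x \<and> 0 < y \<and> y < z}" for T
    by (rule has_sum_reindex_bij_witness
          [of _ "\<lambda>(x, y, z). (- int z, - int y, int x)" "\<lambda>(x, y, z). (nat z, nat (- y), nat (- x))"])
       (auto simp: power_add power_minus [of "real_of_int _"] field_simps)
  hence 3: "(?h has_sum (-1) ^ (b + c) * (mzv3 a b c + mzv3 b a c + mzv3 b c a + mzv2 (a + b) c + mzv2 b (a + c))) ?C3"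
    using has_sum_cmult_right [OF has_sum_stuffle [of a b c]] assms by blast
  have "(?h has_sum (-1) ^ (a + b + c) * T) ?C4 \<longleftrightarrow>
      ((\<lambda>x. (-1) ^ (a + b + c) * ?f a b c x) has_sum (-1) ^ (a + b + c) * T)
        {(x, y, z). 0 < x \<and> x < y \<and> y < z}" for T
    by (rule has_sum_reindex_bij_witness
          [of _ "\<lambda>(x, y, z). (- int z, - int y, - int x)" "\<lambda>(x, y, z). (nat (- z), nat (- y), nat (- x))"])
       (auto simp: power_add power_minus [of "real_of_int _"] field_simps)
  hence 4: "(?h has_sum (-1) ^ (a + b + c) * mzv3 a b c) ?C4"
    using has_sum_cmult_right [OF has_sum_mzv3 [of a b c]] assms by blast
  have "(?h has_sum ?S) (?C1 \<union> ?C2 \<union> ?C3 \<union> ?C4)"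
    by (intro has_sum_Un_disjoint 1 2 3 4) auto
  also have "?this \<longleftrightarrow> (?h has_sum ?S) ?D"
  proof (rule has_sum_cong_neutral)
    fix x assume "x \<in> ?D - (?C1 \<union> ?C2 \<union> ?C3 \<union> ?C4)"
    then obtain i j k where "x = (i, j, k)" "i = 0 \<or> j = 0 \<or> k = 0"
      by (cases x) force
    thus "?h x = 0" using assms by (auto simp: power_0_left)
  qed auto
  finally show ?thesis .
qed

section \<open>Summation over the middle entry for fixed gaps\<close>

text \<open>Symmetric intervals eventually contain every finite set, so an unconditional sum is also
  the limit along them.\<close>

lemma has_sum_imp_sym_sums:
  assumes "(f has_sum S) (UNIV :: int set)"
  shows "sym_sums f S"
  unfolding sym_sums_def
proof (rule filterlim_compose [of "sum f" "nhds S" "finite_subsets_at_top UNIV" "\<lambda>N. {- int N..int N}"])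
  show "(sum f \<longlongrightarrow> S) (finite_subsets_at_top UNIV)"
    using assms by (simp add: has_sum_def)
  show "filterlim (\<lambda>N. {- int N..int N}) (finite_subsets_at_top UNIV) sequentially"
    unfolding filterlim_finite_subsets_at_top
  proof (intro allI impI)
    fix X :: "int set" assume "finite X \<and> X \<subseteq> UNIV"
    hence fin: "finite X" by simp
    show "\<forall>\<^sub>F N in sequentially. finite {- int N..int N} \<and> X \<subseteq> {- int N..int N} \<and> {- int N..int N} \<subseteq> UNIV"
      \<comment> \<open>The sum of all absolute values in \<open>X\<close> is a convenient upper
        bound for each of them.\<close>
      using eventually_ge_at_top [of "\<Sum>x\<in>X. nat \<bar>x\<bar>"]
    proof eventually_elim
      case (elim N)
      have "\<bar>x\<bar> \<le> int N" if "x \<in> X" for x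
        using member_le_sum [OF that, of "\<lambda>x. nat \<bar>x\<bar>"] fin elim by simp
      thus ?case by (auto simp: abs_le_iff) (metis abs_le_iff neg_le_iff_le minus_le_iff)+
    qed
  qed
qed

text \<open>Summability over all triples permits grouping by the gaps \<open>m = z - y\<close>,
  \<open>n = y - x\<close>. For fixed gaps the inner sum over \<open>p = y\<close> is unconditional,
  so it equals its symmetric limit, which is \<open>polar\<close>.\<close>

lemma has_sum_gaps:
  assumes "a \<ge> 2" "b \<ge> 2" "c \<ge> 2"
    and "((\<lambda>(x, y, z). 1 / (real_of_int x ^ c * real_of_int y ^ b * real_of_int z ^ a)) has_sum S)
      {(x, y, z). x < y \<and> y < z}"
  shows "((\<lambda>(m, n). polar (- real m) 0 (real n) a b c) has_sum S) {(m, n). 0 < m \<and> 0 < n}"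
proof -
  let ?h = "\<lambda>(x, y, z). 1 / (real_of_int x ^ c * real_of_int y ^ b * real_of_int z ^ a)"
  let ?g = "\<lambda>((m, n), p). ?h (p - int n, p, p + int m)"
  let ?P = "{(m, n). 0 < m \<and> 0 < n} :: (nat \<times> nat) set"
  have "(?g has_sum S) (?P \<times> UNIV) \<longleftrightarrow> (?h has_sum S) {(x, y, z). x < y \<and> y < z}"
    by (rule has_sum_reindex_bij_witness
          [of _ "\<lambda>(x, y, z). ((nat (z - y), nat (y - x)), y)" "\<lambda>((m, n), p). (p - int n, p, p + int m)"]) auto
  hence g: "(?g has_sum S) (?P \<times> UNIV)" using assms(4) by simp
  show ?thesis
  proof (rule has_sum_SigmaD [OF g])
    fix mn assume "mn \<in> ?P"
    then obtain m n where mn: "mn = (m, n)" "0 < m" "0 < n" by auto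
    have "?g summable_on ?P \<times> UNIV" using g by (rule has_sum_imp_summable)
    hence "?g summable_on {mn} \<times> UNIV"
      by (rule summable_on_subset_banach) (use mn in auto)
    moreover have "?g summable_on {mn} \<times> UNIV \<longleftrightarrow> (\<lambda>p. ?g (mn, p)) summable_on UNIV"
      by (rule summable_on_reindex_bij_witness [of _ "\<lambda>p. (mn, p)" snd]) auto
    ultimately have sum: "((\<lambda>p. ?g (mn, p)) has_sum infsum (\<lambda>p. ?g (mn, p)) UNIV) UNIV"
      by (simp only: has_sum_infsum)
    \<comment> \<open>The positive exponents and \<open>1 / 0 = 0\<close> make the left side vanish
      at \<open>- m\<close>, 0 and \<open>n\<close>, as \<open>recip3\<close> does by
      definition.\<close>
    have "(\<lambda>p. ?g (mn, p)) = recip3 (- int m) 0 (int n) a b c"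
      using assms by (auto simp: recip3_def mn fun_eq_iff power_0_left mult_ac add_ac)
    hence "sym_sums (\<lambda>p. ?g (mn, p)) (polar (- real m) 0 (real n) a b c)"
      using sym_sums_recip3 [of "- int m" 0 "int n" a b c] mn assms by simp
    with has_sum_imp_sym_sums [OF sum]
    have "infsum (\<lambda>p. ?g (mn, p)) UNIV = polar (- real m) 0 (real n) a b c"
      unfolding sym_sums_def by (rule LIMSEQ_unique)
    thus "((\<lambda>p. ?g (mn, p)) has_sum (case mn of (m, n) \<Rightarrow> polar (- real m) 0 (real n) a b c)) UNIV"
      using sum by (simp only: mn prod.case)
  qed
qed

subsection \<open>Contributions of the three poles\<close>

lemma has_sum_finite_sum:
  fixes f :: "'i \<Rightarrow> 'a \<Rightarrow> 'b :: topological_comm_monoid_add"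
  assumes "\<And>i. i \<in> I \<Longrightarrow> (f i has_sum s i) A"
  shows "((\<lambda>x. \<Sum>i\<in>I. f i x) has_sum (\<Sum>i\<in>I. s i)) A"
  using assms by (induction I rule: infinite_finite_induct) (auto intro: has_sum_add has_sum_0)

text \<open>In a Cauchy product the alternating sign of each series cancels against the sign of its
  negative base, leaving \<open>(-1) ^ (b + c)\<close> independently of \<open>k\<close>.\<close>

lemma fps_nth_inv_lin_mult_neg:
  fixes m n :: real
  assumes "m > 0" "n > 0" "b \<ge> 1" "c \<ge> 1"
  shows "(-1) ^ (b + c) * fps_nth (fps_inv_lin (- m) ^ b * fps_inv_lin (- n) ^ c) k
    = (\<Sum>\<omega>=0..k. real ((\<omega> + b - 1) choose \<omega>) * real ((c + (k - \<omega>) - 1) choose (c - 1))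
        * (1 / (m ^ (b + \<omega>) * n ^ (c + (k - \<omega>)))))"
  unfolding fps_mult_nth sum_distrib_left
proof (intro sum.cong refl)
  fix \<omega> assume "\<omega> \<in> {0..k}"
  then obtain j where j: "k = \<omega> + j" by (auto simp: le_iff_add)
  have "(c + j - 1) choose j = (c + j - 1) choose (c - 1)"
    using assms binomial_symmetric [of j "c + j - 1"] by simp
  moreover have "(- m) ^ (b + \<omega>) = (-1) ^ b * (-1) ^ \<omega> * m ^ (b + \<omega>)"
    "(- n) ^ (c + j) = (-1) ^ c * (-1) ^ j * n ^ (c + j)"
    by (subst power_minus; simp add: power_add)+
  ultimately show "(-1) ^ (b + c) * (fps_nth (fps_inv_lin (- m) ^ b) \<omega> * fps_nth (fps_inv_lin (- n) ^ c) (k - \<omega>))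
    = real ((\<omega> + b - 1) choose \<omega>) * real ((c + (k - \<omega>) - 1) choose (c - 1))
        * (1 / (m ^ (b + \<omega>) * n ^ (c + (k - \<omega>))))"
    using assms unfolding j
    by (cases "even b"; cases "even c"; cases "even j"; cases "even \<omega>")
       (simp_all add: fps_nth_inv_lin_power add.commute)
qed

text \<open>Here the bases are positive, so the alternating signs survive and multiply to
  \<open>(-1) ^ k\<close> in every term of the Cauchy product.\<close>

lemma fps_nth_inv_lin_mult_pos:
  fixes m n :: real
  assumes "m > 0" "n > 0" "b \<ge> 1" "a \<ge> 1"
  shows "fps_nth (fps_inv_lin m ^ b * fps_inv_lin n ^ a) k
    = (-1) ^ k * (\<Sum>\<omega>=0..k. real ((\<omega> + b - 1) choose \<omega>) * real ((a + (k - \<omega>) - 1) choose (a - 1))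
        * (1 / (m ^ (b + \<omega>) * n ^ (a + (k - \<omega>)))))"
  unfolding fps_mult_nth sum_distrib_left
proof (intro sum.cong refl)
  fix \<omega> assume "\<omega> \<in> {0..k}"
  then obtain j where j: "k = \<omega> + j" by (auto simp: le_iff_add)
  have "(a + j - 1) choose j = (a + j - 1) choose (a - 1)"
    using assms binomial_symmetric [of j "a + j - 1"] by simp
  thus "fps_nth (fps_inv_lin m ^ b) \<omega> * fps_nth (fps_inv_lin n ^ a) (k - \<omega>)
    = (-1) ^ k * (real ((\<omega> + b - 1) choose \<omega>) * real ((a + (k - \<omega>) - 1) choose (a - 1))
        * (1 / (m ^ (b + \<omega>) * n ^ (a + (k - \<omega>)))))"
    using assms unfolding j
    by (simp add: fps_nth_inv_lin_power add.commute power_add)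
qed

text \<open>The pole \<open>- m\<close> has distances \<open>m\<close> and \<open>m + n\<close> to
  the other two, so its coefficients already have the shape of double zeta terms.\<close>

lemma has_sum_residue_left:
  assumes "b \<ge> 2" "c \<ge> 2"
  shows "((\<lambda>(m, n). (-1) ^ (b + c) *
        fps_nth (fps_inv_lin (- real m) ^ b * fps_inv_lin (- real m - real n) ^ c) k) has_sum
      (\<Sum>\<omega>=0..k. real ((\<omega> + b - 1) choose \<omega>) * real ((c + (k - \<omega>) - 1) choose (c - 1))
        * mzv2 (b + \<omega>) (c + (k - \<omega>)))) {(m, n). 0 < m \<and> 0 < n}"
proof -
  have "((\<lambda>mn. \<Sum>\<omega>=0..k. real ((\<omega> + b - 1) choose \<omega>) * real ((c + (k - \<omega>) - 1) choose (c - 1))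
        * (case mn of (m, n) \<Rightarrow> 1 / (real m ^ (b + \<omega>) * real (m + n) ^ (c + (k - \<omega>))))) has_sum
      (\<Sum>\<omega>=0..k. real ((\<omega> + b - 1) choose \<omega>) * real ((c + (k - \<omega>) - 1) choose (c - 1))
        * mzv2 (b + \<omega>) (c + (k - \<omega>)))) {(m, n). 0 < m \<and> 0 < n}"
    using assms by (intro has_sum_finite_sum has_sum_cmult_right has_sum_mzv2) auto
  also have "?this \<longleftrightarrow> ?thesis"
  proof (rule has_sum_cong, clarify)
    fix m n :: nat assume "0 < m" "0 < n"
    thus "(\<Sum>\<omega>=0..k. real ((\<omega> + b - 1) choose \<omega>) * real ((c + (k - \<omega>) - 1) choose (c - 1))
        * (1 / (real m ^ (b + \<omega>) * real (m + n) ^ (c + (k - \<omega>)))))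
      = (-1) ^ (b + c) * fps_nth (fps_inv_lin (- real m) ^ b * fps_inv_lin (- real m - real n) ^ c) k"
      using fps_nth_inv_lin_mult_neg [of "real m" "real (m + n)" b c k] assms
      by (simp add: algebra_simps)
  qed
  finally show ?thesis .
qed

text \<open>The distances from the pole \<open>n\<close> are \<open>n\<close> and
  \<open>m + n\<close>: the gaps exchange roles, which calls for the flipped form of the double zeta
  sum.\<close>

lemma has_sum_residue_right:
  assumes "b \<ge> 2" "a \<ge> 2"
  shows "((\<lambda>(m, n). fps_nth (fps_inv_lin (real n + real m) ^ a * fps_inv_lin (real n) ^ b) k) has_sum
      (-1) ^ k * (\<Sum>\<omega>=0..k. real ((\<omega> + b - 1) choose \<omega>) * real ((a + (k - \<omega>) - 1) choose (a - 1))
        * mzv2 (b + \<omega>) (a + (k - \<omega>)))) {(m, n). 0 < m \<and> 0 < n}"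
proof -
  have "((\<lambda>mn. (-1) ^ k * (\<Sum>\<omega>=0..k. real ((\<omega> + b - 1) choose \<omega>) * real ((a + (k - \<omega>) - 1) choose (a - 1))
        * (case mn of (m, n) \<Rightarrow> 1 / (real n ^ (b + \<omega>) * real (m + n) ^ (a + (k - \<omega>)))))) has_sum
      (-1) ^ k * (\<Sum>\<omega>=0..k. real ((\<omega> + b - 1) choose \<omega>) * real ((a + (k - \<omega>) - 1) choose (a - 1))
        * mzv2 (b + \<omega>) (a + (k - \<omega>)))) {(m, n). 0 < m \<and> 0 < n}"
    using assms by (intro has_sum_finite_sum has_sum_cmult_right has_sum_mzv2_flip) auto
  also have "?this \<longleftrightarrow> ?thesis"
  proof (rule has_sum_cong, clarify)
    fix m n :: nat assume "0 < m" "0 < n"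
    thus "(-1) ^ k * (\<Sum>\<omega>=0..k. real ((\<omega> + b - 1) choose \<omega>) * real ((a + (k - \<omega>) - 1) choose (a - 1))
        * (1 / (real n ^ (b + \<omega>) * real (m + n) ^ (a + (k - \<omega>)))))
      = fps_nth (fps_inv_lin (real n + real m) ^ a * fps_inv_lin (real n) ^ b) k"
      using fps_nth_inv_lin_mult_pos [of "real n" "real (m + n)" b a k] assms
      by (simp add: add.commute mult.commute)
  qed
  finally show ?thesis .
qed

text \<open>The distances from 0 are \<open>m\<close> and \<open>n\<close>, so partial fractions
  come first. The resulting exponent of \<open>m + n\<close> is at least \<open>c\<close> in the
  first sum and at least \<open>a\<close> in the second, hence at least 2; the other exponent can be
  as small as 1.\<close>

lemma has_sum_residue_mid:
  assumes "a \<ge> 2" "c \<ge> 2"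
  shows "((\<lambda>(m, n). (-1) ^ c * fps_nth (fps_inv_lin (real m) ^ a * fps_inv_lin (- real n) ^ c) k) has_sum
      ((-1) ^ k * (\<Sum>\<omega>=0..a - 1. real ((\<omega> + k) choose \<omega>) * real ((a + c - \<omega> - 2) choose (c - 1))
           * mzv2 (k + \<omega> + 1) (a + c - 1 - \<omega>))
       + (\<Sum>\<omega>=0..c - 1. real ((\<omega> + k) choose \<omega>) * real ((a + c - \<omega> - 2) choose (a - 1))
           * mzv2 (k + \<omega> + 1) (a + c - 1 - \<omega>)))) {(m, n). 0 < m \<and> 0 < n}"
proof -
  have "((\<lambda>mn. (-1) ^ k * (\<Sum>\<omega>=0..a - 1. real ((\<omega> + k) choose \<omega>) * real ((a + c - \<omega> - 2) choose (c - 1))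
           * (case mn of (m, n) \<Rightarrow> 1 / (real m ^ (k + \<omega> + 1) * real (m + n) ^ (a + c - 1 - \<omega>))))
       + (\<Sum>\<omega>=0..c - 1. real ((\<omega> + k) choose \<omega>) * real ((a + c - \<omega> - 2) choose (a - 1))
           * (case mn of (m, n) \<Rightarrow> 1 / (real n ^ (k + \<omega> + 1) * real (m + n) ^ (a + c - 1 - \<omega>))))) has_sum
      ((-1) ^ k * (\<Sum>\<omega>=0..a - 1. real ((\<omega> + k) choose \<omega>) * real ((a + c - \<omega> - 2) choose (c - 1))
           * mzv2 (k + \<omega> + 1) (a + c - 1 - \<omega>))
       + (\<Sum>\<omega>=0..c - 1. real ((\<omega> + k) choose \<omega>) * real ((a + c - \<omega> - 2) choose (a - 1))
           * mzv2 (k + \<omega> + 1) (a + c - 1 - \<omega>)))) {(m, n). 0 < m \<and> 0 < n}"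
    using assms
    by (intro has_sum_add has_sum_cmult_right has_sum_finite_sum has_sum_mzv2 has_sum_mzv2_flip) auto
  also have "?this \<longleftrightarrow> ?thesis"
    by (rule has_sum_cong, clarify, subst fps_nth_inv_lin_mult) (use assms in auto)
  finally show ?thesis .
qed

section \<open>Zeta-weighted pole contributions and comparison of the two evaluations\<close>

lemma has_sum_fps_nth_zeta_even_mult:
  assumes "\<And>\<xi>. \<xi> \<le> N div 2 \<Longrightarrow> ((\<lambda>x. \<kappa> * fps_nth (G x) (N - 2 * \<xi>)) has_sum V \<xi>) A"
  shows "((\<lambda>x. \<kappa> * fps_nth (zeta_even_fps * G x) N) has_sum
    2 * (\<Sum>\<xi>=0..N div 2. rzeta (2 * \<xi>) * V \<xi>)) A"
proof -
  have "((\<lambda>x. 2 * (\<Sum>\<xi>=0..N div 2. rzeta (2 * \<xi>) * (\<kappa> * fps_nth (G x) (N - 2 * \<xi>)))) has_sum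
    2 * (\<Sum>\<xi>=0..N div 2. rzeta (2 * \<xi>) * V \<xi>)) A"
    using assms by (intro has_sum_cmult_right has_sum_finite_sum) auto
  thus ?thesis by (simp add: fps_nth_zeta_even_mult sum_distrib_left mult_ac)
qed

theorem theorem5p2:
  fixes a b c :: nat
  assumes "a \<ge> 2" and "b \<ge> 2" and "c \<ge> 2"
  shows "(1 + (-1) ^ a) * mzv3 a b c
         + (1 + (-1) ^ b) * (mzv3 b a c + mzv3 b c a)
         + (-1) ^ b * (1 + (-1) ^ c) * mzv3 c b a
       = 2 * ( (\<Sum>\<xi>=0..a div 2. rzeta (2*\<xi>) *
                 (\<Sum>\<omega>=0..a - 2*\<xi>. real ((\<omega> + b - 1) choose \<omega>)
                    * real ((a + c - 2*\<xi> - \<omega> - 1) choose (c - 1))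
                    * mzv2 (b + \<omega>) (a + c - 2*\<xi> - \<omega>)))
             + (\<Sum>\<xi>=0..b div 2. rzeta (2*\<xi>) *
                 (\<Sum>\<omega>=0..a - 1. real ((\<omega> + b - 2*\<xi>) choose \<omega>)
                    * real ((a + c - \<omega> - 2) choose (c - 1))
                    * mzv2 (b - 2*\<xi> + \<omega> + 1) (a + c - 1 - \<omega>)))
             + (-1) ^ b * (\<Sum>\<xi>=0..c div 2. rzeta (2*\<xi>) *
                 (\<Sum>\<omega>=0..c - 2*\<xi>. real ((\<omega> + b - 1) choose \<omega>)
                    * real ((a + c - 2*\<xi> - \<omega> - 1) choose (a - 1))
                    * mzv2 (b + \<omega>) (a + c - 2*\<xi> - \<omega>)))
             + (-1) ^ b * (\<Sum>\<xi>=0..b div 2. rzeta (2*\<xi>) *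
                 (\<Sum>\<omega>=0..c - 1. real ((\<omega> + b - 2*\<xi>) choose \<omega>)
                    * real ((a + c - \<omega> - 2) choose (a - 1))
                    * mzv2 (b - 2*\<xi> + \<omega> + 1) (a + c - 1 - \<omega>))) )
         - mzv2 (a + b) c - (1 + (-1) ^ b) * mzv2 b (a + c) - (-1) ^ b * mzv2 (b + c) a"
    (is "?L = 2 * (?R1 + ?R2 + (-1) ^ b * ?R3 + (-1) ^ b * ?R4) - _ - _ - _")
proof -
  let ?P = "{(m, n). 0 < m \<and> 0 < n} :: (nat \<times> nat) set"
  let ?\<kappa> = "(-1) ^ (b + c) :: real"
  let ?E = "fps_inv_lin :: real \<Rightarrow> real fps"
  \<comment> \<open>The value of the triple sum from the sign classification; the factor
    \<open>?\<kappa>\<close> will normalise its signs.\<close>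
  define S where "S = mzv3 c b a
       + (-1) ^ c * (mzv3 c b a + mzv3 b c a + mzv3 b a c + mzv2 (c + b) a + mzv2 b (c + a))
       + (-1) ^ (b + c) * (mzv3 a b c + mzv3 b a c + mzv3 b c a + mzv2 (a + b) c + mzv2 b (a + c))
       + (-1) ^ (a + b + c) * mzv3 a b c"
  have left: "((\<lambda>(m, n). ?\<kappa> * fps_nth (zeta_even_fps * (?E (- real m) ^ b * ?E (- real m - real n) ^ c)) a)
      has_sum 2 * ?R1) ?P"
  proof -
    have "?R1 = (\<Sum>\<xi>=0..a div 2. rzeta (2*\<xi>) *
        (\<Sum>\<omega>=0..a - 2*\<xi>. real ((\<omega> + b - 1) choose \<omega>) * real ((c + (a - 2*\<xi> - \<omega>) - 1) choose (c - 1))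
          * mzv2 (b + \<omega>) (c + (a - 2*\<xi> - \<omega>))))"
    proof (intro sum.cong refl arg_cong2 [where f = "(*)"])
      fix \<xi> \<omega> assume "\<xi> \<in> {0..a div 2}" "\<omega> \<in> {0..a - 2 * \<xi>}"
      \<comment> \<open>The ranges give \<open>2 * \<xi> + \<omega> \<le> a\<close>, so truncated
        subtraction may be regrouped.\<close>
      hence "a + c - 2*\<xi> - \<omega> = c + (a - 2*\<xi> - \<omega>)" by auto
      thus "real ((a + c - 2*\<xi> - \<omega> - 1) choose (c - 1)) = real ((c + (a - 2*\<xi> - \<omega>) - 1) choose (c - 1))"
        "mzv2 (b + \<omega>) (a + c - 2*\<xi> - \<omega>) = mzv2 (b + \<omega>) (c + (a - 2*\<xi> - \<omega>))"
        by (simp_all only:)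
    qed
    moreover have "((\<lambda>x. ?\<kappa> * fps_nth (zeta_even_fps * (case x of (m, n) \<Rightarrow> ?E (- real m) ^ b * ?E (- real m - real n) ^ c)) a)
      has_sum 2 * \<dots>) ?P"
      using has_sum_residue_left [of b c] assms unfolding case_prod_unfold
      by (intro has_sum_fps_nth_zeta_even_mult) blast
    ultimately show ?thesis by (simp add: case_prod_unfold)
  qed
  have right: "((\<lambda>(m, n). ?\<kappa> * fps_nth (zeta_even_fps * (?E (real n + real m) ^ a * ?E (real n) ^ b)) c)
      has_sum 2 * ((-1) ^ b * ?R3)) ?P"
  proof -
    have "(-1) ^ b * ?R3 = (\<Sum>\<xi>=0..c div 2. rzeta (2*\<xi>) * (?\<kappa> * ((-1) ^ (c - 2*\<xi>) *
        (\<Sum>\<omega>=0..c - 2*\<xi>. real ((\<omega> + b - 1) choose \<omega>) * real ((a + (c - 2*\<xi> - \<omega>) - 1) choose (a - 1))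
          * mzv2 (b + \<omega>) (a + (c - 2*\<xi> - \<omega>))))))"
      unfolding sum_distrib_left [of "(-1) ^ b"]
    proof (intro sum.cong refl)
      fix \<xi> assume \<xi>: "\<xi> \<in> {0..c div 2}"
      have "(\<Sum>\<omega>=0..c - 2*\<xi>. real ((\<omega> + b - 1) choose \<omega>) * real ((a + c - 2*\<xi> - \<omega> - 1) choose (a - 1))
          * mzv2 (b + \<omega>) (a + c - 2*\<xi> - \<omega>))
        = (\<Sum>\<omega>=0..c - 2*\<xi>. real ((\<omega> + b - 1) choose \<omega>) * real ((a + (c - 2*\<xi> - \<omega>) - 1) choose (a - 1))
          * mzv2 (b + \<omega>) (a + (c - 2*\<xi> - \<omega>)))" (is "?X = ?Y")
      proof (intro sum.cong refl arg_cong2 [where f = "(*)"])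
        fix \<omega> assume "\<omega> \<in> {0..c - 2 * \<xi>}"
        hence "a + c - 2*\<xi> - \<omega> = a + (c - 2*\<xi> - \<omega>)" using \<xi> by auto
        thus "real ((a + c - 2*\<xi> - \<omega> - 1) choose (a - 1)) = real ((a + (c - 2*\<xi> - \<omega>) - 1) choose (a - 1))"
          "mzv2 (b + \<omega>) (a + c - 2*\<xi> - \<omega>) = mzv2 (b + \<omega>) (a + (c - 2*\<xi> - \<omega>))"
          by (simp_all only:)
      qed
      \<comment> \<open>The sign \<open>(-1) ^ (c - 2*\<xi>)\<close> from the right pole has the
        parity of \<open>c\<close> and cancels that part of \<open>?\<kappa>\<close>.\<close>
      moreover have "(-1) ^ b = ?\<kappa> * (-1) ^ (c - 2*\<xi>)"
        using \<xi> by (cases "even b"; cases "even c") auto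
      ultimately show "(-1) ^ b * (rzeta (2*\<xi>) * ?X) = rzeta (2*\<xi>) * (?\<kappa> * ((-1) ^ (c - 2*\<xi>) * ?Y))"
        by (simp only: mult_ac)
    qed
    moreover have "((\<lambda>x. ?\<kappa> * fps_nth (zeta_even_fps * (case x of (m, n) \<Rightarrow> ?E (real n + real m) ^ a * ?E (real n) ^ b)) c)
      has_sum 2 * \<dots>) ?P"
      using has_sum_residue_right [of b a] assms unfolding case_prod_unfold
      by (intro has_sum_fps_nth_zeta_even_mult has_sum_cmult_right) blast
    ultimately show ?thesis by (simp add: case_prod_unfold)
  qed
  have mid: "((\<lambda>(m, n). ?\<kappa> * fps_nth (zeta_even_fps * (?E (real m) ^ a * ?E (- real n) ^ c)) b)
      has_sum 2 * (?R2 + (-1) ^ b * ?R4)) ?P"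
  proof -
    let ?X = "\<lambda>k. \<Sum>\<omega>=0..a - 1. real ((\<omega> + k) choose \<omega>) * real ((a + c - \<omega> - 2) choose (c - 1))
           * mzv2 (k + \<omega> + 1) (a + c - 1 - \<omega>)"
    let ?Y = "\<lambda>k. \<Sum>\<omega>=0..c - 1. real ((\<omega> + k) choose \<omega>) * real ((a + c - \<omega> - 2) choose (a - 1))
           * mzv2 (k + \<omega> + 1) (a + c - 1 - \<omega>)"
    have "?R2 + (-1) ^ b * ?R4 = (\<Sum>\<xi>=0..b div 2. rzeta (2*\<xi>) *
        ((-1) ^ b * ((-1) ^ (b - 2*\<xi>) * ?X (b - 2*\<xi>) + ?Y (b - 2*\<xi>))))"
      unfolding sum_distrib_left [of "(-1) ^ b"] sum.distrib [symmetric]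
    proof (intro sum.cong refl)
      fix \<xi> assume "\<xi> \<in> {0..b div 2}"
      hence \<xi>: "2 * \<xi> \<le> b" by auto
      hence arg: "\<omega> + b - 2*\<xi> = \<omega> + (b - 2*\<xi>)" for \<omega> by simp
      have sgn: "(-1) ^ (b - 2*\<xi>) = ((-1) ^ b :: real)"
        using \<xi> by (cases "even b") auto
      \<comment> \<open>The expansion at 0 uses up the factor \<open>(-1) ^ c\<close> of
        \<open>?\<kappa>\<close>. The remaining \<open>(-1) ^ b\<close> cancels the sign of the
        first sum and stays in front of the second.\<close>
      have sq: "(-1) ^ b * ((-1) ^ b * z) = z" for z :: real
        by (cases "even b") auto
      show "rzeta (2*\<xi>) * (\<Sum>\<omega>=0..a - 1. real ((\<omega> + b - 2*\<xi>) choose \<omega>) * real ((a + c - \<omega> - 2) choose (c - 1))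
                    * mzv2 (b - 2*\<xi> + \<omega> + 1) (a + c - 1 - \<omega>))
          + (-1) ^ b * (rzeta (2*\<xi>) * (\<Sum>\<omega>=0..c - 1. real ((\<omega> + b - 2*\<xi>) choose \<omega>)
                    * real ((a + c - \<omega> - 2) choose (a - 1)) * mzv2 (b - 2*\<xi> + \<omega> + 1) (a + c - 1 - \<omega>)))
        = rzeta (2*\<xi>) * ((-1) ^ b * ((-1) ^ (b - 2*\<xi>) * ?X (b - 2*\<xi>) + ?Y (b - 2*\<xi>)))"
        unfolding arg sgn distrib_left sq by (simp only: mult.left_commute)
    qed
    moreover have "((\<lambda>x. ?\<kappa> * fps_nth (case x of (m, n) \<Rightarrow> ?E (real m) ^ a * ?E (- real n) ^ c) k)
      has_sum (-1) ^ b * ((-1) ^ k * ?X k + ?Y k)) ?P" for k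
      using has_sum_cmult_right [OF has_sum_residue_mid [of a c k], of "(-1) ^ b"] assms
      by (simp add: case_prod_unfold power_add mult.assoc)
    hence "((\<lambda>x. ?\<kappa> * fps_nth (zeta_even_fps * (case x of (m, n) \<Rightarrow> ?E (real m) ^ a * ?E (- real n) ^ c)) b)
      has_sum 2 * (\<Sum>\<xi>=0..b div 2. rzeta (2*\<xi>) *
        ((-1) ^ b * ((-1) ^ (b - 2*\<xi>) * ?X (b - 2*\<xi>) + ?Y (b - 2*\<xi>))))) ?P"
      by (intro has_sum_fps_nth_zeta_even_mult)
    ultimately show ?thesis by (simp only: case_prod_unfold)
  qed
  have poles: "((\<lambda>(m, n). ?\<kappa> * polar (- real m) 0 (real n) a b c) has_sum
      2 * ?R1 + 2 * (?R2 + (-1) ^ b * ?R4) + 2 * ((-1) ^ b * ?R3)) ?P"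
    using has_sum_add [OF has_sum_add [OF left mid] right]
    by (simp add: polar_def case_prod_unfold distrib_left)
  have "((\<lambda>(m, n). polar (- real m) 0 (real n) a b c) has_sum S) ?P"
    unfolding S_def by (intro has_sum_gaps has_sum_ordered_int_triples assms)
  from has_sum_cmult_right [OF this, of ?\<kappa>]
  have signs: "((\<lambda>(m, n). ?\<kappa> * polar (- real m) 0 (real n) a b c) has_sum ?\<kappa> * S) ?P"
    by (simp only: case_prod_unfold)
  have rhs: "?\<kappa> * S = 2 * (?R1 + ?R2 + (-1) ^ b * ?R3 + (-1) ^ b * ?R4)"
    unfolding has_sum_unique [OF signs poles] by (simp only: distrib_left add_ac)
  \<comment> \<open>Fixing the parities makes all signs explicit; for instance
    \<open>mzv3 a b c\<close> collects \<open>?\<kappa> * ((-1) ^ (b + c) + (-1) ^ (a + b + c)) = 1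
    + (-1) ^ a\<close>.\<close>
  have lhs: "?\<kappa> * S = ?L + mzv2 (a + b) c + (1 + (-1) ^ b) * mzv2 b (a + c) + (-1) ^ b * mzv2 (b + c) a"
    unfolding S_def
    by (cases "even a"; cases "even b"; cases "even c") (simp_all add: add.commute)
  have "l = r - x - y - z" if "v = r" "v = l + x + y + z" for v l r x y z :: real
    using that by simp
  from this [OF rhs lhs] show ?thesis .
qed

end
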